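(* Let $\varepsilon>0$ and $1\le p,q\le2$. Let $v\in V$, and for $\delta>0$ let $v^\delta\in V$ be noisy data with $\|v-v^\delta\|_V\le\delta$. Assume that there exists an $\mathcal{R}_{q,\varepsilon}$-minimizing solution $u^\dagger$ of $F(u)=v$ lying in the Bregman domain $\mathcal{D}_B^\varepsilon(\mathcal{R}_{q,\varepsilon})$, let $\xi\in\partial\mathcal{R}_{q,\varepsilon}(u^\dagger)$, and assume: (i) $F$ is Gâteaux differentiable at $u^\dagger$, with Gâteaux derivative $F'(u^\dagger)$; (ii) there is a constant $\gamma>0$ such that $\|F(u)-F(u^\dagger)-F'(u^\dagger)(u-u^\dagger)\|_V\le\gamma D_\xi^\varepsilon(u,u^\dagger)$ for all $u\in\mathrm{dom}(F)\cap\mathcal{B}_\rho(u^\dagger)$, with $\rho$ sufficiently large, i.e. such that the ball $\mathcal{B}_\rho(u^\dagger)$ contains the minimizers $u_{\alpha,\varepsilon}^\delta$ considered below; (iii) there exists $w\in V^*$ such that $\xi=F'(u^\dagger)^*w$ and $\gamma\|w\|<1$. Put $\beta_1:=\gamma\|w\|$ and $\beta_2:=\|w\|$. Let $\alpha>0$ and let $u_{\alpha,\varepsilon}^\delta$ be a minimizer over $\mathcal{D}$ of $\mathcal{J}_{\alpha,\varepsilon}^{v^\delta}(u)=\|F(u)-v^\delta\|_V^p+\alpha\mathcal{R}_{q,\varepsilon}(u)$. Then: If $p=1$ and $\alpha\beta_2<1$, $$\|F(u_{\alpha,\varepsilon}^\delta)-v^\delta\|_V\le\frac{(1+\alpha\beta_2)\delta}{1-\alpha\beta_2}\quad\text{and}\quad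 D_\xi^\varepsilon(u_{\alpha,\varepsilon}^\delta,u^\dagger)\le\frac{\delta+\alpha\beta_2\delta}{\alpha(1-\beta_1)}.$$ If $p>1$, with $p_*$ the conjugate exponent, $1/p+1/p_*=1$, $$\|F(u_{\alpha,\varepsilon}^\delta)-v^\delta\|_V^p\le p_*\delta^p+p_*\alpha\beta_2\delta+(\alpha\beta_2)^{p_*}\quad\text{and}\quad D_\xi^\varepsilon(u_{\alpha,\varepsilon}^\delta,u^\dagger)\le\frac{\delta^p+\alpha\beta_2\delta+(\alpha\beta_2)^{p_*}/p_*}{\alpha(1-\beta_1)}.$$ Moreover, as $\delta\to0$: for $p=1$ and the choice $\alpha\sim\delta^s$ with fixed $0<s<1$, $$\|F(u_{\alpha,\varepsilon}^\delta)-v^\delta\|_V=\mathcal{O}(\delta)\quad\text{and}\quad D_\xi^\varepsilon(u_{\alpha,\varepsilon}^\delta,u^\dagger)=\mathcal{O}(\delta^{1-s});$$ for $p>1$ and the choice $\alpha\sim\delta^{p-1}$, $$\|F(u_{\alpha,\varepsilon}^\delta)-v^\delta\|_V=\mathcal{O}(\delta)\quad\text{and}\quad D_\xi^\varepsilon(u_{\alpha,\varepsilon}^\delta,u^\dagger)=\mathcal{O}(\delta).$$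
   Context: Setting: $\Omega\subset\mathbb{R}^n$ is a bounded (measurable) set, $U=L_q(\Omega)$ (real-valued functions), $V$ is a reflexive Banach space. For a constant $\varepsilon>0$, $\mathcal{R}_{q,\varepsilon}(u)=\int_\Omega(\max\{|u(x)|-\varepsilon,0\})^q\,dx$ for $u\in U$. $F:\mathrm{dom}(F)\subset U\to V$ is a (possibly nonlinear) operator which is weakly sequentially closed (if $(u_k)\subset\mathrm{dom}(F)$, $u_k\rightharpoonup u$ weakly in $U$ and $F(u_k)\rightharpoonup y$ weakly in $V$, then $u\in\mathrm{dom}(F)$ and $F(u)=y$), and $\mathcal{D}:=\mathrm{dom}(F)\cap\mathrm{dom}(\mathcal{R}_{q,\varepsilon})$ is non-empty, where $\mathrm{dom}(\mathcal{R}_{q,\varepsilon})=\{u\in U:\mathcal{R}_{q,\varepsilon}(u)<\infty\}$. An element $u^\dagger\in\mathrm{dom}(F)$ is an $\mathcal{R}$-minimizing solution of $F(u)=v$ if $F(u^\dagger)=v$ and $\mathcal{R}(u^\dagger)=\min\{\mathcal{R}(u):u\in\mathrm{dom}(F),\ F(u)=v\}$. The subdifferential is $\partial\mathcal{R}_{q,\varepsilon}(u)=\{z\in L_q(\Omega)^*:\mathcal{R}_{q,\varepsilon}(w)\ge\mathcal{R}_{q,\varepsilon}(u)+\langle z,w-u\rangle\ \forall w\in L_q(\Omega)\}$, with $\langle\cdot,\cdot\rangle$ the dual pairing of $L_q(\Omega)^*$ and $L_q(\Omega)$. The Bregman domain is $\mathcal{D}_B^\varepsilon(\mathcal{R}_{q,\varepsilon})=\{u\in\mathrm{dom}(\mathcal{R}_{q,\varepsilon}):\partial\mathcal{R}_{q,\varepsilon}(u)\ne\emptyset\}$.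 For $\xi\in\partial\mathcal{R}_{q,\varepsilon}(u)$ the Bregman distance is $D_\xi^\varepsilon(\tilde u,u)=\mathcal{R}_{q,\varepsilon}(\tilde u)-\mathcal{R}_{q,\varepsilon}(u)-\langle\xi,\tilde u-u\rangle$ for $\tilde u\in L_q(\Omega)$. The Gâteaux derivative $F'(u^\dagger):U\to V$ is a bounded linear operator with adjoint $F'(u^\dagger)^*:V^*\to U^*$. $\mathcal{B}_\rho(u^\dagger)$ is the ball in $U$ of radius $\rho$ centred at $u^\dagger$. For $\alpha:(0,\infty)\to(0,\infty)$ and $s>0$, $\alpha\sim\delta^s$ means that there exist $C\ge c>0$ and $\delta_0>0$ with $c\,\delta^s\le\alpha(\delta)\le C\delta^s$ for $0<\delta<\delta_0$; in the asymptotic statements $\alpha=\alpha(\delta)$. *)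

theory Defs
  imports "HOL-Analysis.Analysis" "HOL-Library.Landau_Symbols" "HOL-Library.FuncSet"
begin

section \<open>Classes of measurable functions\<close>

text \<open>
  Real-valued Lebesgue measurable functions modulo equality almost everywhere.  The space
  \<open>L_q(\<Omega>)\<close> will be the linear subspace of those classes that vanish almost everywhere off \<open>\<Omega>\<close>
  (a function on \<open>\<Omega>\<close> is identified with its extension by zero) and have a finite \<open>q\<close>-th moment.
\<close>

definition ae_eq :: "('a::euclidean_space \<Rightarrow> real) \<Rightarrow> ('a \<Rightarrow> real) \<Rightarrow> bool" where
  "ae_eq f g \<longleftrightarrow> f \<in> borel_measurable lebesgue \<and> g \<in> borel_measurable lebesgue
     \<and> (AE x in lebesgue. f x = g x)"

quotient_type (overloaded) 'a L0 = "'a::euclidean_space \<Rightarrow> real" / partial: ae_eq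
proof (rule part_equivpI)
  show "\<exists>f. ae_eq (f::'a \<Rightarrow> real) f"
    by (rule exI[of _ "\<lambda>_. 0"]) (simp add: ae_eq_def)
  show "symp (ae_eq :: ('a \<Rightarrow> real) \<Rightarrow> _)"
    by (rule sympI) (auto simp: ae_eq_def elim: eventually_mono)
  show "transp (ae_eq :: ('a \<Rightarrow> real) \<Rightarrow> _)"
  proof (rule transpI)
    fix f g h :: "'a \<Rightarrow> real"
    assume fg: "ae_eq f g" and gh: "ae_eq g h"
    have "AE x in lebesgue. f x = g x" "AE x in lebesgue. g x = h x"
      using fg gh by (auto simp: ae_eq_def)
    then have "AE x in lebesgue. f x = h x" by eventually_elim simp
    then show "ae_eq f h" using fg gh by (simp add: ae_eq_def)
  qed
qed

instantiation L0 :: (euclidean_space) real_vector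
begin

lift_definition zero_L0 :: "'a L0" is "\<lambda>_. 0"
  by (simp add: ae_eq_def)

lift_definition plus_L0 :: "'a L0 \<Rightarrow> 'a L0 \<Rightarrow> 'a L0" is "\<lambda>f g x. f x + g x"
proof -
  fix f f' g g' :: "'a \<Rightarrow> real"
  assume a: "ae_eq f f'" and b: "ae_eq g g'"
  have "AE x in lebesgue. f x = f' x" "AE x in lebesgue. g x = g' x"
    using a b by (auto simp: ae_eq_def)
  then have "AE x in lebesgue. f x + g x = f' x + g' x" by eventually_elim simp
  then show "ae_eq (\<lambda>x. f x + g x) (\<lambda>x. f' x + g' x)"
    using a b by (auto simp: ae_eq_def)
qed

lift_definition minus_L0 :: "'a L0 \<Rightarrow> 'a L0 \<Rightarrow> 'a L0" is "\<lambda>f g x. f x - g x"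
proof -
  fix f f' g g' :: "'a \<Rightarrow> real"
  assume a: "ae_eq f f'" and b: "ae_eq g g'"
  have "AE x in lebesgue. f x = f' x" "AE x in lebesgue. g x = g' x"
    using a b by (auto simp: ae_eq_def)
  then have "AE x in lebesgue. f x - g x = f' x - g' x" by eventually_elim simp
  then show "ae_eq (\<lambda>x. f x - g x) (\<lambda>x. f' x - g' x)"
    using a b by (auto simp: ae_eq_def)
qed

lift_definition uminus_L0 :: "'a L0 \<Rightarrow> 'a L0" is "\<lambda>f x. - f x"
  by (auto simp: ae_eq_def)

lift_definition scaleR_L0 :: "real \<Rightarrow> 'a L0 \<Rightarrow> 'a L0" is "\<lambda>c f x. c * f x"
  by (auto simp: ae_eq_def elim: eventually_mono)

instance
  by standard (transfer; auto simp: ae_eq_def algebra_simps)+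

end


section \<open>The space \<open>L_q(\<Omega>)\<close> and its dual\<close>

lift_definition vanishes_off :: "'a::euclidean_space set \<Rightarrow> 'a L0 \<Rightarrow> bool" is
  "\<lambda>\<Omega> f. AE x in lebesgue. x \<notin> \<Omega> \<longrightarrow> f x = 0"
proof -
  fix \<Omega> :: "'a set" and f g :: "'a \<Rightarrow> real"
  assume "ae_eq f g"
  then have "AE x in lebesgue. f x = g x" by (simp add: ae_eq_def)
  then have "AE x in lebesgue. (x \<notin> \<Omega> \<longrightarrow> f x = 0) = (x \<notin> \<Omega> \<longrightarrow> g x = 0)"
    by eventually_elim simp
  then show "(AE x in lebesgue. x \<notin> \<Omega> \<longrightarrow> f x = 0) = (AE x in lebesgue. x \<notin> \<Omega> \<longrightarrow> g x = 0)"
    by (rule eventually_cong) simp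
qed

lift_definition pow_integral :: "real \<Rightarrow> 'a::euclidean_space L0 \<Rightarrow> ennreal" is
  "\<lambda>q f. \<integral>\<^sup>+x. ennreal (\<bar>f x\<bar> powr q) \<partial>lebesgue"
  by (rule nn_integral_cong_AE) (auto simp: ae_eq_def elim: eventually_mono)

definition Lq :: "real \<Rightarrow> 'a::euclidean_space set \<Rightarrow> 'a L0 set" where
  "Lq q \<Omega> = {u. vanishes_off \<Omega> u \<and> pow_integral q u < \<infinity>}"

definition Lq_norm :: "real \<Rightarrow> 'a::euclidean_space L0 \<Rightarrow> real" where
  "Lq_norm q u = (enn2real (pow_integral q u)) powr (1 / q)"

definition Lq_ball :: "real \<Rightarrow> 'a::euclidean_space set \<Rightarrow> 'a L0 \<Rightarrow> real \<Rightarrow> 'a L0 set" where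
  "Lq_ball q \<Omega> u \<rho> = {w \<in> Lq q \<Omega>. Lq_norm q (w - u) < \<rho>}"

definition bounded_linear_Lq ::
  "real \<Rightarrow> 'a::euclidean_space set \<Rightarrow> ('a L0 \<Rightarrow> 'b::real_normed_vector) \<Rightarrow> bool" where
  "bounded_linear_Lq q \<Omega> T \<longleftrightarrow>
     (\<forall>u\<in>Lq q \<Omega>. \<forall>w\<in>Lq q \<Omega>. T (u + w) = T u + T w) \<and>
     (\<forall>c. \<forall>u\<in>Lq q \<Omega>. T (c *\<^sub>R u) = c *\<^sub>R T u) \<and>
     (\<exists>K. \<forall>u\<in>Lq q \<Omega>. norm (T u) \<le> K * Lq_norm q u)"

text \<open>
  Functionals are made extensional, so that equality of elements of the dual is HOL equality;
  the dual pairing is application.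
\<close>

definition Lq_dual :: "real \<Rightarrow> 'a::euclidean_space set \<Rightarrow> ('a L0 \<Rightarrow> real) set" where
  "Lq_dual q \<Omega> = {z \<in> extensional (Lq q \<Omega>). bounded_linear_Lq q \<Omega> z}"

definition Lq_adjoint ::
  "real \<Rightarrow> 'a::euclidean_space set \<Rightarrow> ('a L0 \<Rightarrow> 'v::real_normed_vector)
    \<Rightarrow> ('v \<Rightarrow>\<^sub>L real) \<Rightarrow> 'a L0 \<Rightarrow> real" where
  "Lq_adjoint q \<Omega> T w = (\<lambda>h\<in>Lq q \<Omega>. blinfun_apply w (T h))"


section \<open>Weak convergence, reflexivity, operators\<close>

definition weakly_tendsto_Lq ::
  "real \<Rightarrow> 'a::euclidean_space set \<Rightarrow> (nat \<Rightarrow> 'a L0) \<Rightarrow> 'a L0 \<Rightarrow> bool" where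
  "weakly_tendsto_Lq q \<Omega> X u \<longleftrightarrow>
     range X \<subseteq> Lq q \<Omega> \<and> u \<in> Lq q \<Omega> \<and> (\<forall>z\<in>Lq_dual q \<Omega>. (\<lambda>k. z (X k)) \<longlonglongrightarrow> z u)"

definition weakly_tendsto :: "(nat \<Rightarrow> 'v::real_normed_vector) \<Rightarrow> 'v \<Rightarrow> bool" where
  "weakly_tendsto Y y \<longleftrightarrow> (\<forall>f :: 'v \<Rightarrow>\<^sub>L real. (\<lambda>k. f (Y k)) \<longlonglongrightarrow> f y)"

definition reflexive_space :: "'v::real_normed_vector itself \<Rightarrow> bool" where
  "reflexive_space _ \<longleftrightarrow>
     (\<forall>\<phi> :: ('v \<Rightarrow>\<^sub>L real) \<Rightarrow>\<^sub>L real. \<exists>x::'v. \<forall>f. blinfun_apply \<phi> f = blinfun_apply f x)"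

text \<open>An operator with domain \<open>domF\<close> is a total function whose values off \<open>domF\<close> are irrelevant.\<close>

definition weakly_seq_closed ::
  "real \<Rightarrow> 'a::euclidean_space set \<Rightarrow> 'a L0 set \<Rightarrow> ('a L0 \<Rightarrow> 'v::real_normed_vector) \<Rightarrow> bool" where
  "weakly_seq_closed q \<Omega> domF F \<longleftrightarrow>
     (\<forall>X u y. range X \<subseteq> domF \<and> weakly_tendsto_Lq q \<Omega> X u \<and> weakly_tendsto (\<lambda>k. F (X k)) y
        \<longrightarrow> u \<in> domF \<and> F u = y)"

text \<open>
  The difference quotient must be defined for all sufficiently small \<open>t\<close>: \<open>u\<close> belongs to the
  algebraic interior of \<open>domF\<close>, which makes the derivative unique.
\<close>

definition has_gateaux_derivative ::
  "real \<Rightarrow> 'a::euclidean_space set \<Rightarrow> 'a L0 set \<Rightarrow> ('a L0 \<Rightarrow> 'v::real_normed_vector)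
    \<Rightarrow> 'a L0 \<Rightarrow> ('a L0 \<Rightarrow> 'v) \<Rightarrow> bool" where
  "has_gateaux_derivative q \<Omega> domF F u F' \<longleftrightarrow>
     u \<in> domF \<and> bounded_linear_Lq q \<Omega> F' \<and>
     (\<forall>h\<in>Lq q \<Omega>. (\<forall>\<^sub>F t in at 0. u + t *\<^sub>R h \<in> domF) \<and>
        ((\<lambda>t. (F (u + t *\<^sub>R h) - F u) /\<^sub>R t) \<longlongrightarrow> F' h) (at 0))"


section \<open>The regularization functional\<close>

lift_definition reg_ennreal ::
  "real \<Rightarrow> real \<Rightarrow> 'a::euclidean_space set \<Rightarrow> 'a L0 \<Rightarrow> ennreal" is
  "\<lambda>q \<epsilon> \<Omega> f. \<integral>\<^sup>+x\<in>\<Omega>. ennreal ((max (\<bar>f x\<bar> - \<epsilon>) 0) powr q) \<partial>lebesgue"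
  by (rule nn_integral_cong_AE) (auto simp: ae_eq_def elim: eventually_mono)

definition reg_dom :: "real \<Rightarrow> real \<Rightarrow> 'a::euclidean_space set \<Rightarrow> 'a L0 set" where
  "reg_dom q \<epsilon> \<Omega> = {u \<in> Lq q \<Omega>. reg_ennreal q \<epsilon> \<Omega> u < \<infinity>}"

text \<open>
  The functional as a real number; it is finite on all of \<open>L_q(\<Omega>)\<close> by
  \<open>reg_dom_eq\<close> below, so nothing is lost by \<open>enn2real\<close>.
\<close>

definition reg :: "real \<Rightarrow> real \<Rightarrow> 'a::euclidean_space set \<Rightarrow> 'a L0 \<Rightarrow> real" where
  "reg q \<epsilon> \<Omega> u = enn2real (reg_ennreal q \<epsilon> \<Omega> u)"

definition reg_subdiff ::
  "real \<Rightarrow> real \<Rightarrow> 'a::euclidean_space set \<Rightarrow> 'a L0 \<Rightarrow> ('a L0 \<Rightarrow> real) set" where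
  "reg_subdiff q \<epsilon> \<Omega> u =
     {z \<in> Lq_dual q \<Omega>. \<forall>w\<in>Lq q \<Omega>. reg q \<epsilon> \<Omega> w \<ge> reg q \<epsilon> \<Omega> u + z (w - u)}"

definition bregman_domain :: "real \<Rightarrow> real \<Rightarrow> 'a::euclidean_space set \<Rightarrow> 'a L0 set" where
  "bregman_domain q \<epsilon> \<Omega> = {u \<in> reg_dom q \<epsilon> \<Omega>. reg_subdiff q \<epsilon> \<Omega> u \<noteq> {}}"

definition bregman_dist ::
  "real \<Rightarrow> real \<Rightarrow> 'a::euclidean_space set \<Rightarrow> ('a L0 \<Rightarrow> real) \<Rightarrow> 'a L0 \<Rightarrow> 'a L0 \<Rightarrow> real" where
  "bregman_dist q \<epsilon> \<Omega> \<xi> w u = reg q \<epsilon> \<Omega> w - reg q \<epsilon> \<Omega> u - \<xi> (w - u)"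

definition reg_minimizing_solution ::
  "real \<Rightarrow> real \<Rightarrow> 'a::euclidean_space set \<Rightarrow> 'a L0 set \<Rightarrow> ('a L0 \<Rightarrow> 'v) \<Rightarrow> 'v \<Rightarrow> 'a L0 \<Rightarrow> bool" where
  "reg_minimizing_solution q \<epsilon> \<Omega> domF F v u \<longleftrightarrow>
     u \<in> domF \<and> F u = v \<and> (\<forall>w\<in>domF. F w = v \<longrightarrow> reg q \<epsilon> \<Omega> u \<le> reg q \<epsilon> \<Omega> w)"

definition tikhonov ::
  "real \<Rightarrow> real \<Rightarrow> real \<Rightarrow> 'a::euclidean_space set \<Rightarrow> ('a L0 \<Rightarrow> 'v::real_normed_vector)
    \<Rightarrow> real \<Rightarrow> 'v \<Rightarrow> 'a L0 \<Rightarrow> real" where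
  "tikhonov p q \<epsilon> \<Omega> F \<alpha> vd u = norm (F u - vd) powr p + \<alpha> * reg q \<epsilon> \<Omega> u"

definition tikhonov_minimizer ::
  "real \<Rightarrow> real \<Rightarrow> real \<Rightarrow> 'a::euclidean_space set \<Rightarrow> 'a L0 set \<Rightarrow> ('a L0 \<Rightarrow> 'v::real_normed_vector)
    \<Rightarrow> real \<Rightarrow> 'v \<Rightarrow> 'a L0 \<Rightarrow> bool" where
  "tikhonov_minimizer p q \<epsilon> \<Omega> domF F \<alpha> vd u \<longleftrightarrow>
     u \<in> domF \<inter> reg_dom q \<epsilon> \<Omega> \<and>
     (\<forall>w \<in> domF \<inter> reg_dom q \<epsilon> \<Omega>. tikhonov p q \<epsilon> \<Omega> F \<alpha> vd u \<le> tikhonov p q \<epsilon> \<Omega> F \<alpha> vd w)"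

text \<open>The relation \<open>\<alpha> \<sim> \<delta>\<^sup>s\<close> as \<open>\<delta> \<rightarrow> 0\<close> (two-sided bounds, not asymptotic equivalence).\<close>

definition same_order_as_power :: "(real \<Rightarrow> real) \<Rightarrow> real \<Rightarrow> bool" where
  "same_order_as_power \<alpha> s \<longleftrightarrow>
     (\<exists>c C \<delta>0. 0 < c \<and> c \<le> C \<and> 0 < \<delta>0 \<and>
        (\<forall>\<delta>. 0 < \<delta> \<and> \<delta> < \<delta>0 \<longrightarrow> c * \<delta> powr s \<le> \<alpha> \<delta> \<and> \<alpha> \<delta> \<le> C * \<delta> powr s))"


section \<open>Basic facts\<close>

lemma abs_add_powr_le:
  fixes a b q :: real
  assumes "q \<ge> 0"
  shows "\<bar>a + b\<bar> powr q \<le> 2 powr q * (\<bar>a\<bar> powr q + \<bar>b\<bar> powr q)"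
proof -
  have "\<bar>a + b\<bar> powr q \<le> (2 * max \<bar>a\<bar> \<bar>b\<bar>) powr q"
    using assms by (intro powr_mono2) auto
  also have "\<dots> = 2 powr q * (max \<bar>a\<bar> \<bar>b\<bar>) powr q"
    by (simp add: powr_mult)
  also have "\<dots> \<le> 2 powr q * (\<bar>a\<bar> powr q + \<bar>b\<bar> powr q)"
    by (auto simp: max_def)
  finally show ?thesis .
qed

lemma pow_integral_add:
  assumes "q \<ge> 0"
  shows "pow_integral q (u + w) \<le> ennreal (2 powr q) * (pow_integral q u + pow_integral q w)"
proof (transfer fixing: q)
  fix f g :: "'a \<Rightarrow> real"
  assume "ae_eq f f" "ae_eq g g"
  then have [measurable]: "f \<in> borel_measurable lebesgue" "g \<in> borel_measurable lebesgue"
    by (auto simp: ae_eq_def)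
  have "(\<integral>\<^sup>+x. ennreal (\<bar>f x + g x\<bar> powr q) \<partial>lebesgue)
      \<le> (\<integral>\<^sup>+x. ennreal (2 powr q) * (ennreal (\<bar>f x\<bar> powr q) + ennreal (\<bar>g x\<bar> powr q)) \<partial>lebesgue)"
    using abs_add_powr_le[OF assms]
    by (intro nn_integral_mono) (simp flip: ennreal_plus ennreal_mult)
  also have "\<dots> = ennreal (2 powr q) *
      ((\<integral>\<^sup>+x. ennreal (\<bar>f x\<bar> powr q) \<partial>lebesgue) + (\<integral>\<^sup>+x. ennreal (\<bar>g x\<bar> powr q) \<partial>lebesgue))"
    by (subst nn_integral_cmult, measurable) (subst nn_integral_add, auto)
  finally show "(\<integral>\<^sup>+x. ennreal (\<bar>f x + g x\<bar> powr q) \<partial>lebesgue) \<le> ennreal (2 powr q) *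
      ((\<integral>\<^sup>+x. ennreal (\<bar>f x\<bar> powr q) \<partial>lebesgue) + (\<integral>\<^sup>+x. ennreal (\<bar>g x\<bar> powr q) \<partial>lebesgue))" .
qed

lemma pow_integral_scaleR:
  "pow_integral q (c *\<^sub>R u) = ennreal (\<bar>c\<bar> powr q) * pow_integral q u"
proof (transfer fixing: q c)
  fix f :: "'a \<Rightarrow> real"
  assume "ae_eq f f"
  then have [measurable]: "f \<in> borel_measurable lebesgue"
    by (auto simp: ae_eq_def)
  show "(\<integral>\<^sup>+x. ennreal (\<bar>c * f x\<bar> powr q) \<partial>lebesgue)
      = ennreal (\<bar>c\<bar> powr q) * (\<integral>\<^sup>+x. ennreal (\<bar>f x\<bar> powr q) \<partial>lebesgue)"
    by (subst nn_integral_cmult[symmetric]) (auto simp: abs_mult powr_mult ennreal_mult)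
qed

lemma vanishes_off_add: "vanishes_off \<Omega> u \<Longrightarrow> vanishes_off \<Omega> w \<Longrightarrow> vanishes_off \<Omega> (u + w)"
  by transfer (erule (1) eventually_elim2, simp)

lemma vanishes_off_scaleR: "vanishes_off \<Omega> u \<Longrightarrow> vanishes_off \<Omega> (c *\<^sub>R u)"
  by transfer (erule eventually_mono, simp)

lemma Lq_add: "q \<ge> 0 \<Longrightarrow> u \<in> Lq q \<Omega> \<Longrightarrow> w \<in> Lq q \<Omega> \<Longrightarrow> u + w \<in> Lq q \<Omega>"
  using pow_integral_add[of q u w]
  by (auto simp: Lq_def vanishes_off_add ennreal_mult_less_top elim!: order.strict_trans1)

lemma Lq_scaleR: "u \<in> Lq q \<Omega> \<Longrightarrow> c *\<^sub>R u \<in> Lq q \<Omega>"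
  by (auto simp: Lq_def vanishes_off_scaleR pow_integral_scaleR ennreal_mult_less_top)

lemma Lq_diff: "q \<ge> 0 \<Longrightarrow> u \<in> Lq q \<Omega> \<Longrightarrow> w \<in> Lq q \<Omega> \<Longrightarrow> u - w \<in> Lq q \<Omega>"
  using Lq_add[of q u \<Omega> "-1 *\<^sub>R w"] Lq_scaleR[of w q \<Omega> "-1"] by simp

lemma reg_ennreal_le_pow_integral:
  assumes "q \<ge> 0" "\<epsilon> \<ge> 0"
  shows "reg_ennreal q \<epsilon> \<Omega> u \<le> pow_integral q u"
proof (transfer fixing: q \<epsilon> \<Omega>)
  fix f :: "'a \<Rightarrow> real"
  show "(\<integral>\<^sup>+x\<in>\<Omega>. ennreal ((max (\<bar>f x\<bar> - \<epsilon>) 0) powr q) \<partial>lebesgue)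
      \<le> (\<integral>\<^sup>+x. ennreal (\<bar>f x\<bar> powr q) \<partial>lebesgue)"
    using assms
    by (intro nn_integral_mono) (auto simp: indicator_def intro!: ennreal_leI powr_mono2)
qed

lemma reg_dom_eq:
  assumes "q \<ge> 0" "\<epsilon> \<ge> 0"
  shows "reg_dom q \<epsilon> \<Omega> = Lq q \<Omega>"
  using reg_ennreal_le_pow_integral[OF assms, of \<Omega>]
  by (auto simp: reg_dom_def Lq_def intro: order.strict_trans1)

end

theory Submission
  imports Defs
begin

text \<open>
  Write \<open>r = \<parallel>F u - v\<^sup>\<delta>\<parallel>\<close> and \<open>D = D\<^sub>\<xi>(u, u\<^sup>\<dagger>)\<close>.  The source condition turns \<open>- \<langle>\<xi>, u - u\<^sup>\<dagger>\<rangle>\<close> into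
  \<open>- w (F'(u - u\<^sup>\<dagger>))\<close>, which by the nonlinearity condition is at most
  \<open>\<beta>\<^sub>1 D + \<beta>\<^sub>2 (r + \<delta>)\<close>.  Comparing the Tikhonov functional at the minimizer \<open>u\<close> with its value
  at \<open>u\<^sup>\<dagger>\<close> then gives the single inequality
  \<open>r\<^sup>p + \<alpha> (1 - \<beta>\<^sub>1) D \<le> \<delta>\<^sup>p + \<alpha> \<beta>\<^sub>2 (r + \<delta>)\<close>.  For \<open>p = 1\<close> the term \<open>\<alpha> \<beta>\<^sub>2 r\<close> is absorbed
  directly, for \<open>p > 1\<close> by Young's inequality.
\<close>

section \<open>The basic inequality for a Tikhonov minimizer\<close>

lemma bregman_dist_nonneg:
  assumes "\<xi> \<in> reg_subdiff q \<epsilon> \<Omega> u0" and "u \<in> Lq q \<Omega>"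
  shows "bregman_dist q \<epsilon> \<Omega> \<xi> u u0 \<ge> 0"
  using assms by (force simp: reg_subdiff_def bregman_dist_def)

text \<open>The vector \<open>F' (u - u0)\<close> is the difference of the residuals of
  \<open>u\<close> and \<open>u0\<close> minus the linearization error, so three norms bound it;
  pairing with \<open>w\<close> costs the factor \<open>norm w\<close>. The Bregman distance enters
  only as a number \<open>D\<close>.\<close>

lemma neg_source_element_le:
  fixes w :: "'v::real_normed_vector \<Rightarrow>\<^sub>L real"
  assumes source: "\<xi> = Lq_adjoint q \<Omega> F' w" and "u - u0 \<in> Lq q \<Omega>"
    and nonlin: "norm (F u - F u0 - F' (u - u0)) \<le> \<gamma> * D"
    and noise: "norm (F u0 - y) \<le> \<delta>"
  shows "- \<xi> (u - u0) \<le> \<gamma> * norm w * D + norm w * (norm (F u - y) + \<delta>)"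
proof -
  have "F' (u - u0) = ((F u - y) - (F u0 - y)) - (F u - F u0 - F' (u - u0))"
    by simp
  then have "norm (F' (u - u0)) \<le> norm (F u - y) + norm (F u0 - y)
      + norm (F u - F u0 - F' (u - u0))"
    by (smt (verit) norm_triangle_ineq4)
  also have "\<dots> \<le> norm (F u - y) + \<delta> + \<gamma> * D"
    using nonlin noise by linarith
  finally have le: "norm (F' (u - u0)) \<le> norm (F u - y) + \<delta> + \<gamma> * D" .
  have "- \<xi> (u - u0) \<le> norm w * norm (F' (u - u0))"
    using assms(2) norm_blinfun[of w "F' (u - u0)"] by (simp add: source Lq_adjoint_def)
  also have "\<dots> \<le> norm w * (norm (F u - y) + \<delta> + \<gamma> * D)"
    using le by (simp add: mult_left_mono)
  finally show ?thesis by (simp add: algebra_simps)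
qed

lemma tikhonov_minimizer_estimate:
  fixes F F' :: "'a::euclidean_space L0 \<Rightarrow> 'v::real_normed_vector" and w :: "'v \<Rightarrow>\<^sub>L real"
  assumes "p \<ge> 0" "q \<ge> 0" "\<epsilon> \<ge> 0" "\<alpha> \<ge> 0" and "domF \<subseteq> Lq q \<Omega>" and "u0 \<in> domF"
    and min: "tikhonov_minimizer p q \<epsilon> \<Omega> domF F \<alpha> y u"
    and source: "\<xi> = Lq_adjoint q \<Omega> F' w"
    and nonlin: "norm (F u - F u0 - F' (u - u0)) \<le> \<gamma> * bregman_dist q \<epsilon> \<Omega> \<xi> u u0"
    and noise: "norm (F u0 - y) \<le> \<delta>"
  shows "norm (F u - y) powr p + \<alpha> * (1 - \<gamma> * norm w) * bregman_dist q \<epsilon> \<Omega> \<xi> u u0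
    \<le> \<delta> powr p + \<alpha> * norm w * (norm (F u - y) + \<delta>)"
proof -
  let ?D = "bregman_dist q \<epsilon> \<Omega> \<xi> u u0"
  have u: "u \<in> Lq q \<Omega>" and u0: "u0 \<in> Lq q \<Omega>"
    using min assms by (auto simp: tikhonov_minimizer_def)
  \<comment> \<open>The element \<open>u0\<close> is an admissible competitor: by
    \<open>reg_dom_eq\<close> the functional is finite on all of
    \<open>Lq q \<Omega>\<close>.\<close>
  have "norm (F u - y) powr p + \<alpha> * reg q \<epsilon> \<Omega> u \<le> norm (F u0 - y) powr p + \<alpha> * reg q \<epsilon> \<Omega> u0"
    using min u0 assms by (auto simp: tikhonov_minimizer_def tikhonov_def reg_dom_eq)
  also have "norm (F u0 - y) powr p \<le> \<delta> powr p"
    using noise \<open>p \<ge> 0\<close> by (intro powr_mono2) auto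
  \<comment> \<open>By definition of the Bregman distance, \<open>reg u - reg u0\<close> is
    \<open>?D\<close> plus the pairing with \<xi>. The share \<open>\<gamma> * norm w * ?D\<close>
    of the bound on that pairing later moves to the left and produces the factor
    \<open>1 - \<gamma> * norm w\<close>.\<close>
  finally have "norm (F u - y) powr p + \<alpha> * ?D \<le> \<delta> powr p + \<alpha> * (- \<xi> (u - u0))"
    by (simp add: bregman_dist_def algebra_simps)
  also have "\<alpha> * (- \<xi> (u - u0)) \<le> \<alpha> * (\<gamma> * norm w * ?D + norm w * (norm (F u - y) + \<delta>))"
    using neg_source_element_le[OF source Lq_diff[OF \<open>q \<ge> 0\<close> u u0] nonlin noise] \<open>\<alpha> \<ge> 0\<close>
    by (rule mult_left_mono)
  finally show ?thesis by (simp add: algebra_simps)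
qed

section \<open>Absorbing the residual on the right-hand side\<close>

text \<open>Applied with \<open>a = \<alpha> * \<beta>2\<close> and
  \<open>c = \<alpha> * (1 - \<beta>1)\<close>. After moving \<open>a * r\<close> to the left, both
  summands \<open>(1 - a) * r\<close> and \<open>c * D\<close> are nonnegative; dropping one bounds
  the other.\<close>

lemma linear_absorption:
  fixes r D \<delta> a c :: real
  assumes est: "r + c * D \<le> \<delta> + a * (r + \<delta>)" and "a < 1" "r \<ge> 0" "c > 0" "D \<ge> 0"
  shows "r \<le> (1 + a) * \<delta> / (1 - a)" and "D \<le> (\<delta> + a * \<delta>) / c"
proof -
  have "c * D \<ge> 0" and "(1 - a) * r \<ge> 0"
    using assms by auto
  then have "(1 - a) * r \<le> (1 + a) * \<delta>" "c * D \<le> \<delta> + a * \<delta>"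
    using est unfolding ring_distribs by linarith+
  then show "r \<le> (1 + a) * \<delta> / (1 - a)" "D \<le> (\<delta> + a * \<delta>) / c"
    using assms by (simp_all add: pos_le_divide_eq mult.commute)
qed

text \<open>Young's inequality bounds \<open>a * r\<close> by
  \<open>r powr p / p + a powr p' / p'\<close>. Since 1 - 1/p = 1/p', the share
  \<open>r powr p / p'\<close> survives on the left, and again either nonnegative summand may be
  dropped. Multiplying by \<open>p'\<close> gives the first bound.\<close>

lemma young_absorption:
  fixes r D \<delta> a c :: real
  assumes est: "r powr p + c * D \<le> \<delta> powr p + a * (r + \<delta>)"
    and p: "p > 1" "1 / p + 1 / p' = 1" and "a \<ge> 0" "r \<ge> 0" "c > 0" "D \<ge> 0"
  shows "r powr p \<le> p' * \<delta> powr p + p' * a * \<delta> + a powr p'"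
    and "D \<le> (\<delta> powr p + a * \<delta> + a powr p' / p') / c"
proof -
  \<comment> \<open>This value lies strictly between 0 and 1, which rules out \<open>p' = 0\<close>
    (where \<open>1 / p'\<close> would be 0 by convention) and gives \<open>p' > 1\<close>.\<close>
  have inv: "1 / p' = 1 - 1 / p" using p by simp
  have "1 / p' > 0" using p(1) unfolding inv by simp
  then have p': "p' > 0" by simp
  have "1 / p' < 1" using p(1) unfolding inv by simp
  then have "p' > 1" using p' by simp
  have "r * a \<le> r powr p / p + a powr p' / p'"
    using Youngs_inequality[of p p' r a] p \<open>p' > 1\<close> assms by simp
  moreover have "r powr p / p' = r powr p - r powr p / p"
    using arg_cong[OF inv, of "\<lambda>x. r powr p * x"] by (simp add: right_diff_distrib)
  ultimately have main: "r powr p / p' + c * D \<le> \<delta> powr p + a * \<delta> + a powr p' / p'"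
    using est by (simp add: algebra_simps)
  have "c * D \<ge> 0" "r powr p / p' \<ge> 0" using assms p' by auto
  then have "r powr p / p' \<le> \<delta> powr p + a * \<delta> + a powr p' / p'"
    and "c * D \<le> \<delta> powr p + a * \<delta> + a powr p' / p'"
    using main by linarith+
  then show "r powr p \<le> p' * \<delta> powr p + p' * a * \<delta> + a powr p'"
    and "D \<le> (\<delta> powr p + a * \<delta> + a powr p' / p') / c"
    using p' \<open>c > 0\<close> by (simp_all add: field_simps)
qed

section \<open>From estimates to convergence rates\<close>

lemma same_order_as_power_eventually:
  assumes "same_order_as_power \<alpha> s"
  obtains c C where "0 < c" "0 < C"
    "\<forall>\<^sub>F \<delta> in at_right 0. c * \<delta> powr s \<le> \<alpha> \<delta> \<and> \<alpha> \<delta> \<le> C * \<delta> powr s"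
proof -
  obtain c C \<delta>0 where c: "0 < c" "c \<le> C" "0 < \<delta>0"
    and bounds: "\<And>\<delta>. 0 < \<delta> \<Longrightarrow> \<delta> < \<delta>0 \<Longrightarrow> c * \<delta> powr s \<le> \<alpha> \<delta> \<and> \<alpha> \<delta> \<le> C * \<delta> powr s"
    using assms by (auto simp: same_order_as_power_def)
  then have "\<forall>\<^sub>F \<delta> in at_right 0. c * \<delta> powr s \<le> \<alpha> \<delta> \<and> \<alpha> \<delta> \<le> C * \<delta> powr s"
    by (auto simp: eventually_at_right_field)
  with c show ?thesis by (intro that[of c C]) auto
qed

text \<open>Here \<open>b\<close> stands for \<beta>2 and \<open>k\<close> for 1 - \<beta>1. The
  upper bound on \<alpha> drives \<open>\<alpha> \<delta> * b\<close> to 0, so that the conditional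
  estimate eventually applies with denominators away from 0; the lower bound controls the division
  by \<alpha> in the estimate of \<open>D\<close>.\<close>

lemma linear_rates:
  fixes \<alpha> r D :: "real \<Rightarrow> real"
  assumes order: "same_order_as_power \<alpha> s" and "s > 0" and "b \<ge> 0" "k > 0"
    and \<alpha>: "\<And>\<delta>. \<delta> > 0 \<Longrightarrow> \<alpha> \<delta> > 0"
    and nonneg: "\<forall>\<^sub>F \<delta> in at_right 0. r \<delta> \<ge> 0 \<and> D \<delta> \<ge> 0"
    and est: "\<forall>\<^sub>F \<delta> in at_right 0. \<alpha> \<delta> * b < 1 \<longrightarrow>
      r \<delta> \<le> (1 + \<alpha> \<delta> * b) * \<delta> / (1 - \<alpha> \<delta> * b) \<and>
      D \<delta> \<le> (\<delta> + \<alpha> \<delta> * b * \<delta>) / (\<alpha> \<delta> * k)"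
  shows "r \<in> O[at_right 0](\<lambda>\<delta>. \<delta>)" and "D \<in> O[at_right 0](\<lambda>\<delta>. \<delta> powr (1 - s))"
proof -
  obtain c C where "0 < c"
    and ord: "\<forall>\<^sub>F \<delta> in at_right 0. c * \<delta> powr s \<le> \<alpha> \<delta> \<and> \<alpha> \<delta> \<le> C * \<delta> powr s"
    using same_order_as_power_eventually[OF order] by metis
  have pos: "\<forall>\<^sub>F \<delta> in at_right 0. \<delta> > (0::real)"
    by (rule eventually_at_right_less)
  have "((\<lambda>\<delta>. C * \<delta> powr s * b) \<longlongrightarrow> C * 0 * b) (at_right 0)"
    using \<open>s > 0\<close> eventually_mono[OF pos less_imp_le]
    by (intro tendsto_intros tendsto_zero_powrI) auto
  then have small: "\<forall>\<^sub>F \<delta> in at_right 0. C * \<delta> powr s * b < 1 / 2"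
    by (rule order_tendstoD) simp
  \<comment> \<open>With \<open>a = \<alpha> \<delta> * b\<close> below 1/2, the quotient (1 + a) /
    (1 - a) is at most (3/2) / (1/2) = 3, and 1 + a is at most 2.\<close>
  have "\<forall>\<^sub>F \<delta> in at_right 0. norm (r \<delta>) \<le> 3 * norm \<delta> \<and>
      norm (D \<delta>) \<le> (2 / (c * k)) * norm (\<delta> powr (1 - s))"
    using pos nonneg est ord small
  proof eventually_elim
    case (elim \<delta>)
    let ?a = "\<alpha> \<delta> * b"
    have "?a \<le> C * \<delta> powr s * b"
      using elim \<open>b \<ge> 0\<close> by (intro mult_right_mono) auto
    then have a: "?a < 1 / 2" "?a \<ge> 0"
      using elim \<alpha>[of \<delta>] \<open>b \<ge> 0\<close> by auto
    have "r \<delta> \<le> (1 + ?a) * \<delta> / (1 - ?a)" using elim a by auto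
    also have "\<dots> \<le> ((3/2) * \<delta>) / (1 / 2)"
      using a elim by (intro frac_le mult_right_mono mult_nonneg_nonneg) auto
    finally have r: "r \<delta> \<le> 3 * \<delta>" by simp
    have "D \<delta> \<le> (\<delta> + ?a * \<delta>) / (\<alpha> \<delta> * k)" using elim a by auto
    also have "\<dots> \<le> (2 * \<delta>) / (c * \<delta> powr s * k)"
    proof (rule frac_le)
      have "?a * \<delta> \<le> 1 * \<delta>" using a elim by (intro mult_right_mono) auto
      then show "\<delta> + ?a * \<delta> \<le> 2 * \<delta>" by simp
    qed (use elim \<open>c > 0\<close> \<open>k > 0\<close> in auto)
    also have "\<dots> = (2 / (c * k)) * \<delta> powr (1 - s)"
      using elim by (simp add: powr_diff)
    finally show ?case using r elim by simp
  qed
  then show "r \<in> O[at_right 0](\<lambda>\<delta>. \<delta>)" "D \<in> O[at_right 0](\<lambda>\<delta>. \<delta> powr (1 - s))"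
    unfolding eventually_conj_iff by (blast intro: bigoI)+
qed

text \<open>The choice of order \<delta>^(p-1) balances the terms: \<alpha> \<delta> and \<alpha>^p'
  are both of order \<delta>^p, because (p - 1) p' = p. Taking p-th roots gives the rate of
  \<open>r\<close>; dividing by \<alpha> leaves one power of \<delta> for \<open>D\<close>.\<close>

lemma power_rates:
  fixes \<alpha> r D :: "real \<Rightarrow> real"
  assumes order: "same_order_as_power \<alpha> (p - 1)" and p: "p > 1" "1 / p + 1 / p' = 1"
    and "b \<ge> 0" "k > 0" and \<alpha>: "\<And>\<delta>. \<delta> > 0 \<Longrightarrow> \<alpha> \<delta> > 0"
    and nonneg: "\<forall>\<^sub>F \<delta> in at_right 0. r \<delta> \<ge> 0 \<and> D \<delta> \<ge> 0"
    and est: "\<forall>\<^sub>F \<delta> in at_right 0.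
      r \<delta> powr p \<le> p' * \<delta> powr p + p' * (\<alpha> \<delta> * b) * \<delta> + (\<alpha> \<delta> * b) powr p' \<and>
      D \<delta> \<le> (\<delta> powr p + \<alpha> \<delta> * b * \<delta> + (\<alpha> \<delta> * b) powr p' / p') / (\<alpha> \<delta> * k)"
  shows "r \<in> O[at_right 0](\<lambda>\<delta>. \<delta>)" and "D \<in> O[at_right 0](\<lambda>\<delta>. \<delta>)"
proof -
  obtain c C where "0 < c" "0 < C"
    and ord: "\<forall>\<^sub>F \<delta> in at_right 0. c * \<delta> powr (p - 1) \<le> \<alpha> \<delta> \<and> \<alpha> \<delta> \<le> C * \<delta> powr (p - 1)"
    using same_order_as_power_eventually[OF order] by metis
  have inv: "1 / p' = 1 - 1 / p" using p by simp
  have "1 / p' > 0" using p(1) unfolding inv by simp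
  then have p': "p' > 0" by simp
  have conj: "(p - 1) * p' = p"
    using p p' by (simp add: field_simps)
  \<comment> \<open>The summands are the coefficients of \<delta>^p in the bounds for the three
    terms that estimate \<open>r \<delta> powr p\<close>.\<close>
  define K where "K = p' + p' * (C * b) + (C * b) powr p'"
  have "K \<ge> 0" using p' \<open>C > 0\<close> \<open>b \<ge> 0\<close> by (simp add: K_def)
  have pos: "\<forall>\<^sub>F \<delta> in at_right 0. \<delta> > (0::real)"
    by (rule eventually_at_right_less)
  have "\<forall>\<^sub>F \<delta> in at_right 0. norm (r \<delta>) \<le> K powr (1 / p) * norm \<delta> \<and>
      norm (D \<delta>) \<le> (K / p' / (c * k)) * norm \<delta>"
    using pos nonneg est ord
  proof eventually_elim
    case (elim \<delta>)
    let ?a = "\<alpha> \<delta> * b"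
    have a: "?a \<le> (C * b) * \<delta> powr (p - 1)"
      using mult_right_mono[of "\<alpha> \<delta>" "C * \<delta> powr (p - 1)" b] elim \<open>b \<ge> 0\<close>
      by (simp add: mult_ac)
    have a0: "?a \<ge> 0" using \<alpha>[of \<delta>] elim \<open>b \<ge> 0\<close> by simp
    have split: "\<delta> powr (p - 1) * \<delta> = \<delta> powr p"
      using elim by (simp add: powr_diff)
    have 1: "?a * \<delta> \<le> (C * b) * \<delta> powr p"
      using mult_right_mono[OF a, of \<delta>] elim by (simp add: mult.assoc split)
    have "?a powr p' \<le> ((C * b) * \<delta> powr (p - 1)) powr p'"
      using a a0 p' by (intro powr_mono2) auto
    then have 2: "?a powr p' \<le> (C * b) powr p' * \<delta> powr p"
      using \<open>C > 0\<close> \<open>b \<ge> 0\<close> by (simp add: powr_mult powr_powr conj)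
    have bound: "p' * \<delta> powr p + p' * ?a * \<delta> + ?a powr p' \<le> K * \<delta> powr p"
      using mult_left_mono[OF 1, of p'] 2 p' by (simp add: K_def algebra_simps)
    have "r \<delta> powr p \<le> K * \<delta> powr p" using elim bound by linarith
    then have "(r \<delta> powr p) powr (1 / p) \<le> (K * \<delta> powr p) powr (1 / p)"
      using p by (intro powr_mono2) auto
    then have r: "r \<delta> \<le> K powr (1 / p) * \<delta>"
      using elim p \<open>K \<ge> 0\<close> by (simp add: powr_mult powr_powr)
    \<comment> \<open>The numerator in the estimate of \<open>D\<close> is the bound for
      \<open>r \<delta> powr p\<close> divided by \<open>p'\<close>, so the same \<open>K\<close>
      serves.\<close>
    have "\<delta> powr p + ?a * \<delta> + ?a powr p' / p' \<le> K / p' * \<delta> powr p"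
      using divide_right_mono[OF bound, of p'] p' by (simp add: add_divide_distrib)
    moreover have "c * \<delta> powr (p - 1) * k \<le> \<alpha> \<delta> * k"
      using elim \<open>k > 0\<close> by (intro mult_right_mono) auto
    ultimately have "(\<delta> powr p + ?a * \<delta> + ?a powr p' / p') / (\<alpha> \<delta> * k)
        \<le> (K / p' * \<delta> powr p) / (c * \<delta> powr (p - 1) * k)"
      using elim \<open>c > 0\<close> \<open>k > 0\<close> p' \<open>K \<ge> 0\<close> by (intro frac_le) auto
    \<comment> \<open>Splitting \<delta>^p as \<delta>^(p-1) times \<delta> cancels the power in the
      denominator.\<close>
    also have "\<dots> = (K / p' / (c * k)) * \<delta>"
      using elim by (simp flip: split)
    finally have "D \<delta> \<le> (K / p' / (c * k)) * \<delta>" using elim by linarith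
    with r show ?case using elim by simp
  qed
  then show "r \<in> O[at_right 0](\<lambda>\<delta>. \<delta>)" "D \<in> O[at_right 0](\<lambda>\<delta>. \<delta>)"
    unfolding eventually_conj_iff by (blast intro: bigoI)+
qed

section \<open>Error estimates and rates for the minimizers\<close>

text \<open>That \<rho> is sufficiently large is expressed by requiring the minimizers under
  consideration to lie in the ball; in the asymptotic part this is asked only for small
  \<delta>.\<close>

theorem theorem15:
  fixes \<Omega> :: "(real ^ 'n) set"
    and p q \<epsilon> \<gamma> \<rho> \<beta>1 \<beta>2 :: real
    and domF :: "(real ^ 'n) L0 set"
    and F F' :: "(real ^ 'n) L0 \<Rightarrow> 'v::banach"
    and v :: 'v
    and vd :: "real \<Rightarrow> 'v"
    and u0 :: "(real ^ 'n) L0"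
    and \<xi> :: "(real ^ 'n) L0 \<Rightarrow> real"
    and w :: "'v \<Rightarrow>\<^sub>L real"
  assumes "bounded \<Omega>" and "\<Omega> \<in> sets lebesgue"
    and "reflexive_space TYPE('v)"
    and "\<epsilon> > 0" and "1 \<le> p" and "p \<le> 2" and "1 \<le> q" and "q \<le> 2"
    and "domF \<subseteq> Lq q \<Omega>"
    and "weakly_seq_closed q \<Omega> domF F"
    and "domF \<inter> reg_dom q \<epsilon> \<Omega> \<noteq> {}"
    and noise: "\<And>\<delta>. \<delta> > 0 \<Longrightarrow> norm (v - vd \<delta>) \<le> \<delta>"
    and "reg_minimizing_solution q \<epsilon> \<Omega> domF F v u0"
    and "u0 \<in> bregman_domain q \<epsilon> \<Omega>"
    and "\<xi> \<in> reg_subdiff q \<epsilon> \<Omega> u0"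
    and "has_gateaux_derivative q \<Omega> domF F u0 F'"
    and "\<gamma> > 0" and "\<rho> > 0"
    and nonlinearity: "\<And>u. u \<in> domF \<inter> Lq_ball q \<Omega> u0 \<rho> \<Longrightarrow>
           norm (F u - F u0 - F' (u - u0)) \<le> \<gamma> * bregman_dist q \<epsilon> \<Omega> \<xi> u u0"
    and source: "\<xi> = Lq_adjoint q \<Omega> F' w" and "\<gamma> * norm w < 1"
    and "\<beta>1 = \<gamma> * norm w" and "\<beta>2 = norm w"
  shows
    "(\<forall>\<delta> \<alpha> u. \<delta> > 0 \<and> \<alpha> > 0 \<and> tikhonov_minimizer p q \<epsilon> \<Omega> domF F \<alpha> (vd \<delta>) u
          \<and> u \<in> Lq_ball q \<Omega> u0 \<rho> \<longrightarrow>
        (p = 1 \<and> \<alpha> * \<beta>2 < 1 \<longrightarrow>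
           norm (F u - vd \<delta>) \<le> (1 + \<alpha> * \<beta>2) * \<delta> / (1 - \<alpha> * \<beta>2) \<and>
           bregman_dist q \<epsilon> \<Omega> \<xi> u u0 \<le> (\<delta> + \<alpha> * \<beta>2 * \<delta>) / (\<alpha> * (1 - \<beta>1))) \<and>
        (\<forall>p'. p > 1 \<and> 1 / p + 1 / p' = 1 \<longrightarrow>
           norm (F u - vd \<delta>) powr p
             \<le> p' * \<delta> powr p + p' * \<alpha> * \<beta>2 * \<delta> + (\<alpha> * \<beta>2) powr p' \<and>
           bregman_dist q \<epsilon> \<Omega> \<xi> u u0
             \<le> (\<delta> powr p + \<alpha> * \<beta>2 * \<delta> + (\<alpha> * \<beta>2) powr p' / p') / (\<alpha> * (1 - \<beta>1))))
     \<and>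
     (\<forall>\<alpha> ud. (\<forall>\<delta>>0. \<alpha> \<delta> > 0)
          \<and> (\<forall>\<^sub>F \<delta> in at_right 0. tikhonov_minimizer p q \<epsilon> \<Omega> domF F (\<alpha> \<delta>) (vd \<delta>) (ud \<delta>)
                \<and> ud \<delta> \<in> Lq_ball q \<Omega> u0 \<rho>) \<longrightarrow>
        (\<forall>s. p = 1 \<and> 0 < s \<and> s < 1 \<and> same_order_as_power \<alpha> s \<longrightarrow>
           (\<lambda>\<delta>. norm (F (ud \<delta>) - vd \<delta>)) \<in> O[at_right 0](\<lambda>\<delta>. \<delta>) \<and>
           (\<lambda>\<delta>. bregman_dist q \<epsilon> \<Omega> \<xi> (ud \<delta>) u0) \<in> O[at_right 0](\<lambda>\<delta>. \<delta> powr (1 - s))) \<and>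
        (p > 1 \<and> same_order_as_power \<alpha> (p - 1) \<longrightarrow>
           (\<lambda>\<delta>. norm (F (ud \<delta>) - vd \<delta>)) \<in> O[at_right 0](\<lambda>\<delta>. \<delta>) \<and>
           (\<lambda>\<delta>. bregman_dist q \<epsilon> \<Omega> \<xi> (ud \<delta>) u0) \<in> O[at_right 0](\<lambda>\<delta>. \<delta>)))"
proof -
  note defs = \<open>\<beta>1 = \<gamma> * norm w\<close> \<open>\<beta>2 = norm w\<close>
  have u0: "u0 \<in> domF" "F u0 = v"
    using \<open>reg_minimizing_solution q \<epsilon> \<Omega> domF F v u0\<close> by (auto simp: reg_minimizing_solution_def)
  have \<beta>: "1 - \<beta>1 > 0" "\<beta>2 \<ge> 0"
    using \<open>\<gamma> * norm w < 1\<close> by (simp_all add: defs)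
  have nonneg: "bregman_dist q \<epsilon> \<Omega> \<xi> u u0 \<ge> 0" if "u \<in> Lq_ball q \<Omega> u0 \<rho>" for u
    using that bregman_dist_nonneg[OF \<open>\<xi> \<in> reg_subdiff q \<epsilon> \<Omega> u0\<close>] by (simp add: Lq_ball_def)
  \<comment> \<open>The parentheses mark the coefficients \<open>c\<close> and \<open>a\<close> of
    the absorption lemmas.\<close>
  have est: "norm (F u - vd \<delta>) powr p + (\<alpha> * (1 - \<beta>1)) * bregman_dist q \<epsilon> \<Omega> \<xi> u u0
      \<le> \<delta> powr p + (\<alpha> * \<beta>2) * (norm (F u - vd \<delta>) + \<delta>)"
    if "\<delta> > 0" "\<alpha> > 0" "tikhonov_minimizer p q \<epsilon> \<Omega> domF F \<alpha> (vd \<delta>) u" "u \<in> Lq_ball q \<Omega> u0 \<rho>"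
    for \<delta> \<alpha> u
    unfolding defs
  proof (rule tikhonov_minimizer_estimate[where F' = F'])
    show "norm (F u - F u0 - F' (u - u0)) \<le> \<gamma> * bregman_dist q \<epsilon> \<Omega> \<xi> u u0"
      using that by (intro nonlinearity) (auto simp: tikhonov_minimizer_def)
    show "norm (F u0 - vd \<delta>) \<le> \<delta>" using noise that u0 by simp
  qed (use that assms u0 in auto)
  have linear: "norm (F u - vd \<delta>) \<le> (1 + \<alpha> * \<beta>2) * \<delta> / (1 - \<alpha> * \<beta>2) \<and>
      bregman_dist q \<epsilon> \<Omega> \<xi> u u0 \<le> (\<delta> + \<alpha> * \<beta>2 * \<delta>) / (\<alpha> * (1 - \<beta>1))"
    if "\<delta> > 0" "\<alpha> > 0" "tikhonov_minimizer p q \<epsilon> \<Omega> domF F \<alpha> (vd \<delta>) u" "u \<in> Lq_ball q \<Omega> u0 \<rho>"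
      "p = 1" "\<alpha> * \<beta>2 < 1" for \<delta> \<alpha> u
  proof -
    have "norm (F u - vd \<delta>) + (\<alpha> * (1 - \<beta>1)) * bregman_dist q \<epsilon> \<Omega> \<xi> u u0
        \<le> \<delta> + (\<alpha> * \<beta>2) * (norm (F u - vd \<delta>) + \<delta>)"
      using est[OF that(1-4)] that(1,5) by simp
    from linear_absorption[OF this \<open>\<alpha> * \<beta>2 < 1\<close>] show ?thesis
      using nonneg that \<beta> by simp
  qed
  \<comment> \<open>The product \<open>p' * (\<alpha> * \<beta>2)\<close> is bracketed to fit
    \<open>power_rates\<close>; \<open>mult.assoc\<close> reconciles it with the goal at the
    end.\<close>
  have power: "norm (F u - vd \<delta>) powr p
        \<le> p' * \<delta> powr p + p' * (\<alpha> * \<beta>2) * \<delta> + (\<alpha> * \<beta>2) powr p' \<and>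
      bregman_dist q \<epsilon> \<Omega> \<xi> u u0
        \<le> (\<delta> powr p + \<alpha> * \<beta>2 * \<delta> + (\<alpha> * \<beta>2) powr p' / p') / (\<alpha> * (1 - \<beta>1))"
    if "\<delta> > 0" "\<alpha> > 0" "tikhonov_minimizer p q \<epsilon> \<Omega> domF F \<alpha> (vd \<delta>) u" "u \<in> Lq_ball q \<Omega> u0 \<rho>"
      "p > 1" "1 / p + 1 / p' = 1" for \<delta> \<alpha> u p'
    using young_absorption[OF est[OF that(1-4)] that(5,6)] nonneg that \<beta> by simp
  have rates: "(\<forall>s. p = 1 \<and> 0 < s \<and> s < 1 \<and> same_order_as_power \<alpha> s \<longrightarrow>
           (\<lambda>\<delta>. norm (F (ud \<delta>) - vd \<delta>)) \<in> O[at_right 0](\<lambda>\<delta>. \<delta>) \<and>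
           (\<lambda>\<delta>. bregman_dist q \<epsilon> \<Omega> \<xi> (ud \<delta>) u0) \<in> O[at_right 0](\<lambda>\<delta>. \<delta> powr (1 - s))) \<and>
        (p > 1 \<and> same_order_as_power \<alpha> (p - 1) \<longrightarrow>
           (\<lambda>\<delta>. norm (F (ud \<delta>) - vd \<delta>)) \<in> O[at_right 0](\<lambda>\<delta>. \<delta>) \<and>
           (\<lambda>\<delta>. bregman_dist q \<epsilon> \<Omega> \<xi> (ud \<delta>) u0) \<in> O[at_right 0](\<lambda>\<delta>. \<delta>))"
    if \<alpha>: "\<forall>\<delta>>0. \<alpha> \<delta> > 0"
      and ud: "\<forall>\<^sub>F \<delta> in at_right 0. tikhonov_minimizer p q \<epsilon> \<Omega> domF F (\<alpha> \<delta>) (vd \<delta>) (ud \<delta>)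
                \<and> ud \<delta> \<in> Lq_ball q \<Omega> u0 \<rho>" for \<alpha> ud
  proof (intro conjI allI impI; elim conjE)
    let ?r = "\<lambda>\<delta>. norm (F (ud \<delta>) - vd \<delta>)" and ?D = "\<lambda>\<delta>. bregman_dist q \<epsilon> \<Omega> \<xi> (ud \<delta>) u0"
    have nn: "\<forall>\<^sub>F \<delta> in at_right 0. ?r \<delta> \<ge> 0 \<and> ?D \<delta> \<ge> 0"
      using ud by eventually_elim (simp add: nonneg)
    have pos: "\<forall>\<^sub>F \<delta> in at_right 0. \<delta> > (0::real)"
      by (rule eventually_at_right_less)
    {
      fix s :: real
      assume s: "p = 1" "0 < s" "same_order_as_power \<alpha> s"
      have "\<forall>\<^sub>F \<delta> in at_right 0. \<alpha> \<delta> * \<beta>2 < 1 \<longrightarrow>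
          ?r \<delta> \<le> (1 + \<alpha> \<delta> * \<beta>2) * \<delta> / (1 - \<alpha> \<delta> * \<beta>2) \<and>
          ?D \<delta> \<le> (\<delta> + \<alpha> \<delta> * \<beta>2 * \<delta>) / (\<alpha> \<delta> * (1 - \<beta>1))"
        using ud pos by eventually_elim (use linear \<alpha> s in blast)
      note * = linear_rates[OF s(3,2) \<beta>(2,1) _ nn this]
      show "?r \<in> O[at_right 0](\<lambda>\<delta>. \<delta>)" "?D \<in> O[at_right 0](\<lambda>\<delta>. \<delta> powr (1 - s))"
        using * \<alpha> by simp_all
    }
    {
      assume p: "p > 1" "same_order_as_power \<alpha> (p - 1)"
      \<comment> \<open>The rates do not mention the conjugate exponent, so it is supplied
        explicitly as p / (p - 1).\<close>
      have conj: "1 / p + 1 / (p / (p - 1)) = 1" using p by (simp add: field_simps)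
      note * = power_rates[OF p(2,1) conj \<beta>(2,1) _ nn]
      have "\<forall>\<^sub>F \<delta> in at_right 0.
          ?r \<delta> powr p \<le> p / (p - 1) * \<delta> powr p + p / (p - 1) * (\<alpha> \<delta> * \<beta>2) * \<delta>
            + (\<alpha> \<delta> * \<beta>2) powr (p / (p - 1)) \<and>
          ?D \<delta> \<le> (\<delta> powr p + \<alpha> \<delta> * \<beta>2 * \<delta> + (\<alpha> \<delta> * \<beta>2) powr (p / (p - 1)) / (p / (p - 1)))
            / (\<alpha> \<delta> * (1 - \<beta>1))"
        using ud pos by eventually_elim (use power[OF _ _ _ _ p(1) conj] \<alpha> in blast)
      then show "?r \<in> O[at_right 0](\<lambda>\<delta>. \<delta>)" "?D \<in> O[at_right 0](\<lambda>\<delta>. \<delta>)"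
        using * \<alpha> by simp_all
    }
  qed
  show ?thesis
    using linear power rates by (simp only: mult.assoc) blast
qed

end
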